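(* In the standing setting of the context, assume that there exists an open neighborhood $\mathcal{N}(t_0)\subset(0,1)^m$ of $t_0$ such that, for any $t\in\mathcal{N}(t_0)$, the $\phi$-projection of $t$ on $\mathcal{M}=\mathcal{S}(\bar\Theta)$ exists and is unique. Then the function $\mathcal{S}^*:\mathcal{N}(t_0)\to\mathcal{M}$ defined by $$\mathcal{S}^*(t)=\operatorname*{arg\,inf}_{s\in\mathcal{M}}D_\phi(s\mid t)$$ is continuous at $t_0$.
   Context: Fix a positive integer $m$. The function $\phi:[0,\infty)\to\mathbb{R}$ is convex and continuous at $0$. Define $f:[0,\infty)^2\to\mathbb{R}\cup\{\infty\}$ by $f(v,w)=w\,\phi(v/w)$ if $v\ge 0$, $w>0$; $f(v,0)=v\lim_{x\to\infty}\phi(x)/x$ if $v>0$ (the limit exists in $\mathbb{R}\cup\{\infty\}$); and $f(0,0)=0$. For $s,t\in[0,\infty)^m$, $D_\phi(s\mid t)=\sum_{i=1}^m f(s_i,t_i)$. A $\phi$-projection of $t$ on a nonempty set $\mathcal{M}$ is an element $s^*\in\mathcal{M}$ with $D_\phi(s^*\mid t)=\inf_{s\in\mathcal{M}}D_\phi(s\mid t)$. Standing assumptions: $\phi$ is strictly convex and twice continuously differentiable on $(0,\infty)$. For some positive integer $k\le m$, $\Theta\subset\mathbb{R}^k$ is bounded, with closure $\bar\Theta$ and nonempty interior $\mathring\Theta$; $\mathcal{S}:\bar\Theta\to[0,1]^m$ is continuous, injective, twice continuously differentiable on $\mathring\Theta$, and satisfies $\mathcal{S}(\mathring\Theta)\subset(0,1)^m$;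 and $\mathcal{M}=\mathcal{S}(\bar\Theta)$. A point $t_0\in(0,1)^m$ is fixed. *)

theory Defs
  imports "HOL-Analysis.Analysis"
begin

definition strictly_convex_on :: "real set \<Rightarrow> (real \<Rightarrow> real) \<Rightarrow> bool" where
  "strictly_convex_on S f \<longleftrightarrow> convex S \<and>
     (\<forall>x\<in>S. \<forall>y\<in>S. \<forall>u. x \<noteq> y \<longrightarrow> 0 < u \<longrightarrow> u < 1 \<longrightarrow>
        f ((1 - u) * x + u * y) < (1 - u) * f x + u * f y)"

text \<open>Twice continuously differentiable on an open set, via Frechet derivatives.\<close>

definition C2_on :: "'a::real_normed_vector set \<Rightarrow> ('a \<Rightarrow> 'b::real_normed_vector) \<Rightarrow> bool" where
  "C2_on U f \<longleftrightarrow> open U \<and>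
     (\<exists>(f' :: 'a \<Rightarrow> 'a \<Rightarrow>\<^sub>L 'b) (f'' :: 'a \<Rightarrow> 'a \<Rightarrow>\<^sub>L ('a \<Rightarrow>\<^sub>L 'b)).
        (\<forall>x\<in>U. (f has_derivative blinfun_apply (f' x)) (at x)) \<and>
        (\<forall>x\<in>U. (f' has_derivative blinfun_apply (f'' x)) (at x)) \<and>
        continuous_on U f'')"

text \<open>The function \<open>\<phi>\<close>, defined on the nonnegative reals, is represented by a total function;
  only its values on \<open>{0..}\<close> are used, and the next two definitions are only meaningful for
  nonnegative arguments. For convex \<open>\<phi>\<close> the limit of \<open>\<phi> x / x\<close> is real or \<open>\<infinity>\<close>, so
  the sum defining the divergence never contains \<open>-\<infinity>\<close>.\<close>

definition div_term :: "(real \<Rightarrow> real) \<Rightarrow> real \<Rightarrow> real \<Rightarrow> ereal" where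
  "div_term \<phi> v w =
     (if w > 0 then ereal (w * \<phi> (v / w))
      else if v > 0 then ereal v * Lim at_top (\<lambda>x. ereal (\<phi> x / x))
      else 0)"

definition phi_div :: "(real \<Rightarrow> real) \<Rightarrow> real ^ 'm \<Rightarrow> real ^ 'm \<Rightarrow> ereal" where
  "phi_div \<phi> s t = (\<Sum>i\<in>UNIV. div_term \<phi> (s $ i) (t $ i))"

definition is_phi_projection ::
    "(real \<Rightarrow> real) \<Rightarrow> (real ^ 'm) set \<Rightarrow> real ^ 'm \<Rightarrow> real ^ 'm \<Rightarrow> bool" where
  "is_phi_projection \<phi> M t s \<longleftrightarrow> s \<in> M \<and> phi_div \<phi> s t = (INF s'\<in>M. phi_div \<phi> s' t)"

text \<open>The arg inf; only meaningful where the projection exists and is unique.\<close>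

definition phi_projection ::
    "(real \<Rightarrow> real) \<Rightarrow> (real ^ 'm) set \<Rightarrow> real ^ 'm \<Rightarrow> real ^ 'm" where
  "phi_projection \<phi> M t = (THE s. is_phi_projection \<phi> M t s)"

end

theory Submission
  imports Defs
begin

text \<open>For positive \<open>t\<close> the divergence is the real number \<open>\<Sum>\<^sub>i t\<^sub>i \<phi>(s\<^sub>i / t\<^sub>i)\<close>, jointly continuous
  in \<open>s\<close> and \<open>t\<close> because \<open>\<phi>\<close> is continuous on \<open>[0,\<infinity>)\<close>. Hence the relation ``\<open>s\<close> minimizes the
  divergence from \<open>t\<close> over \<open>\<M>\<close>'' is closed, and a function into a compact set with closed graph
  is continuous.\<close>

lemma continuous_on_argmin:
  fixes F :: "'a::euclidean_space \<Rightarrow> 'b::euclidean_space \<Rightarrow> real"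
  assumes "compact M"
    and cont: "continuous_on (N \<times> M) (\<lambda>p. F (fst p) (snd p))"
    and argmin: "\<And>t s. t \<in> N \<Longrightarrow> p t = s \<longleftrightarrow> s \<in> M \<and> (\<forall>s'\<in>M. F t s \<le> F t s')"
  shows "continuous_on N p"
proof -
  \<comment> \<open>Taking \<open>s = p t\<close> in \<open>argmin\<close> gives existence of the
    minimizer; read from right to left, \<open>argmin\<close> gives its uniqueness.\<close>
  have pM: "p \<in> N \<rightarrow> M"
    using argmin by blast
  have "closedin (top_of_set (N \<times> M)) ((N \<times> M) \<inter> (\<lambda>q. F (fst q) (snd q) - F (fst q) s') -` {..0})"
    if "s' \<in> M" for s'
  proof -
    \<comment> \<open>With the competitor \<open>s'\<close> fixed, the second term of the difference
      is the objective composed with a map that stays inside \<open>N \<times> M\<close>.\<close>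
    have "continuous_on (N \<times> M) ((\<lambda>q. F (fst q) (snd q)) \<circ> (\<lambda>q. (fst q, s')))"
      by (rule continuous_on_compose)
        (auto intro!: continuous_intros continuous_on_subset[OF cont] simp: that)
    then have "continuous_on (N \<times> M) (\<lambda>q. F (fst q) (snd q) - F (fst q) s')"
      using cont by (auto intro: continuous_on_diff simp: o_def)
    then show ?thesis
      by (rule continuous_closedin_preimage) simp
  qed
  \<comment> \<open>An intersection over an empty index set would be the whole space, so
    \<open>M = {}\<close> is split off; the outer \<open>N \<times> M\<close> makes the set empty
    there.\<close>
  then have "closedin (top_of_set (N \<times> M))
      (N \<times> M \<inter> (\<Inter>s'\<in>M. N \<times> M \<inter> (\<lambda>q. F (fst q) (snd q) - F (fst q) s') -` {..0}))"
    by (cases "M = {}") (simp, rule closedin_Int, simp, rule closedin_INT, simp_all)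
  \<comment> \<open>Existence puts the graph inside the intersection; uniqueness leaves nothing else
    in it.\<close>
  also have "N \<times> M \<inter> (\<Inter>s'\<in>M. N \<times> M \<inter> (\<lambda>q. F (fst q) (snd q) - F (fst q) s') -` {..0})
      = (\<lambda>t. Pair t (p t)) ` N"
  proof -
    have "F t (p t) \<le> F t s'" if "t \<in> N" "s' \<in> M" for t s'
      using argmin that by blast
    moreover have "s = p t" if "t \<in> N" "s \<in> M" "\<forall>s'\<in>M. F t s \<le> F t s'" for t s
      using argmin that by metis
    ultimately show ?thesis
      using pM by (auto simp: image_iff)
  qed
  finally show ?thesis
    using continuous_closed_graph_eq[OF \<open>compact M\<close> pM] by simp
qed

lemma phi_div_pos:
  assumes "\<And>i. 0 < t $ i"
  shows "phi_div \<phi> s t = ereal (\<Sum>i\<in>UNIV. t $ i * \<phi> (s $ i / t $ i))"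
  using assms by (simp add: phi_div_def div_term_def)

text \<open>A member of \<open>M\<close> attains the infimum exactly when its value is a lower
  bound. Positivity of \<open>t\<close> makes all values finite, so extended reals disappear and the
  form required by \<open>continuous_on_argmin\<close> remains.\<close>

lemma is_phi_projection_pos_iff:
  assumes "\<And>i. 0 < t $ i"
  shows "is_phi_projection \<phi> M t s \<longleftrightarrow>
    s \<in> M \<and> (\<forall>s'\<in>M. (\<Sum>i\<in>UNIV. t $ i * \<phi> (s $ i / t $ i)) \<le> (\<Sum>i\<in>UNIV. t $ i * \<phi> (s' $ i / t $ i)))"
proof -
  have "phi_div \<phi> s t = (INF s'\<in>M. phi_div \<phi> s' t) \<longleftrightarrow> (\<forall>s'\<in>M. phi_div \<phi> s t \<le> phi_div \<phi> s' t)"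
    if "s \<in> M"
  proof
    assume "phi_div \<phi> s t = (INF s'\<in>M. phi_div \<phi> s' t)"
    then show "\<forall>s'\<in>M. phi_div \<phi> s t \<le> phi_div \<phi> s' t"
      by (metis INF_lower)
  qed (use that in \<open>auto intro!: antisym INF_greatest INF_lower\<close>)
  then show ?thesis
    using assms by (auto simp: is_phi_projection_def phi_div_pos)
qed

text \<open>Positive denominators and nonnegative numerators keep each quotient in
  \<open>{0..}\<close>. Coordinates of \<open>s\<close> may vanish, so continuity of
  \<open>\<phi>\<close> at 0 matters.\<close>

lemma continuous_on_phi_div_sum:
  fixes \<phi> :: "real \<Rightarrow> real" and N M :: "(real ^ 'm) set"
  assumes \<phi>: "continuous_on {0..} \<phi>"
    and N: "\<And>t i. t \<in> N \<Longrightarrow> 0 < t $ i"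
    and M: "\<And>s i. s \<in> M \<Longrightarrow> 0 \<le> s $ i"
  shows "continuous_on (N \<times> M) (\<lambda>p. \<Sum>i\<in>UNIV. fst p $ i * \<phi> (snd p $ i / fst p $ i))"
proof (intro continuous_on_sum continuous_on_mult)
  fix i :: 'm
  have "continuous_on (N \<times> M) (\<lambda>p. snd p $ i / fst p $ i)"
    using N by (auto intro!: continuous_intros simp: less_imp_neq[symmetric])
  then show "continuous_on (N \<times> M) (\<lambda>p. \<phi> (snd p $ i / fst p $ i))"
    by (rule continuous_on_compose2[OF \<phi>]) (use N M in \<open>force intro: divide_nonneg_pos\<close>)
qed (intro continuous_intros)

lemma continuous_on_of_C2_pos:
  fixes \<phi> :: "real \<Rightarrow> real"
  assumes "continuous (at 0 within {0..}) \<phi>" and "C2_on {0<..} \<phi>"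
  shows "continuous_on {0..} \<phi>"
  unfolding continuous_on_eq_continuous_within
proof
  fix x :: real assume "x \<in> {0..}"
  show "continuous (at x within {0..}) \<phi>"
  proof (cases "x = 0")
    case False
    with \<open>x \<in> {0..}\<close> have "x \<in> {0<..}"
      by simp
    then have "isCont \<phi> x"
      using \<open>C2_on {0<..} \<phi>\<close> unfolding C2_on_def by (blast intro: has_derivative_continuous)
    then show ?thesis
      by (rule continuous_at_imp_continuous_at_within)
  qed (use assms in simp)
qed

theorem corollary16:
  fixes \<phi> :: "real \<Rightarrow> real"
    and \<Theta> :: "(real ^ 'k) set"
    and \<S> :: "real ^ 'k \<Rightarrow> real ^ 'm"
    and \<M> N :: "(real ^ 'm) set"
    and t0 :: "real ^ 'm"
  assumes "convex_on {0..} \<phi>"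
    and "continuous (at 0 within {0..}) \<phi>"
    and "strictly_convex_on {0<..} \<phi>"
    and "C2_on {0<..} \<phi>"
    and "CARD('k) \<le> CARD('m)"
    and "bounded \<Theta>"
    and "interior \<Theta> \<noteq> {}"
    and "\<forall>\<theta>\<in>closure \<Theta>. \<forall>i. 0 \<le> \<S> \<theta> $ i \<and> \<S> \<theta> $ i \<le> 1"
    and "continuous_on (closure \<Theta>) \<S>"
    and "inj_on \<S> (closure \<Theta>)"
    and "C2_on (interior \<Theta>) \<S>"
    and "\<forall>\<theta>\<in>interior \<Theta>. \<forall>i. 0 < \<S> \<theta> $ i \<and> \<S> \<theta> $ i < 1"
    and "\<M> = \<S> ` closure \<Theta>"
    and "\<forall>i. 0 < t0 $ i \<and> t0 $ i < 1"
    and "open N"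
    and "t0 \<in> N"
    and "\<forall>t\<in>N. \<forall>i. 0 < t $ i \<and> t $ i < 1"
    and "\<forall>t\<in>N. \<exists>!s. is_phi_projection \<phi> \<M> t s"
  shows "continuous (at t0 within N) (phi_projection \<phi> \<M>)"
proof -
  have "compact \<M>"
    using assms(6,9,13) by (simp add: compact_continuous_image)
  moreover have "continuous_on (N \<times> \<M>)
      (\<lambda>p. \<Sum>i\<in>UNIV. fst p $ i * \<phi> (snd p $ i / fst p $ i))"
    by (rule continuous_on_phi_div_sum) (use assms(2,4,8,13,17) in \<open>auto intro: continuous_on_of_C2_pos\<close>)
  moreover have "phi_projection \<phi> \<M> t = s \<longleftrightarrow> s \<in> \<M> \<and>
      (\<forall>s'\<in>\<M>. (\<Sum>i\<in>UNIV. t $ i * \<phi> (s $ i / t $ i)) \<le> (\<Sum>i\<in>UNIV. t $ i * \<phi> (s' $ i / t $ i)))"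
    if "t \<in> N" for t s
  proof -
    have "\<exists>!s. is_phi_projection \<phi> \<M> t s"
      using assms(18) that by blast
    \<comment> \<open>Unique existence turns the definite description into an equivalence.\<close>
    then have "phi_projection \<phi> \<M> t = s \<longleftrightarrow> is_phi_projection \<phi> \<M> t s"
      unfolding phi_projection_def by (metis theI')
    then show ?thesis
      using assms(17) that by (simp add: is_phi_projection_pos_iff)
  qed
  \<comment> \<open>Continuity holds on all of \<open>N\<close>; the claim is the instance at
    \<open>t0\<close>.\<close>
  ultimately have "continuous_on N (phi_projection \<phi> \<M>)"
    by (rule continuous_on_argmin)
  then show ?thesis
    using \<open>t0 \<in> N\<close> by (simp add: continuous_on_eq_continuous_within)
qed

end
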